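(* Let $H$ and $G$ be groups with neutral elements $e_H$ and $e_G$, and let $P = H \ast G$ be their free product. Let $r, r' \ge 1$ be integers and suppose that $w = h_1 g_1 h_2 g_2 \cdots h_r g_r$ and $w' = h'_1 g'_1 h'_2 g'_2 \cdots h'_{r'} g'_{r'}$ are two reduced words of type 1 (so $h_i, h'_j \in H\setminus\{e_H\}$ and $g_i, g'_j \in G \setminus\{e_G\}$), representing elements $x$ and $x'$ of $P$ such that $x\cdot x' = x'\cdot x$. Let $c$ be the greatest common divisor of $r$ and $r'$. Then there exists a reduced word of type 1, $w_0 = h''_1 g''_1 h''_2 g''_2 \cdots h''_c g''_c$ (with $h''_i \in H\setminus\{e_H\}$, $g''_i \in G\setminus\{e_G\}$), such that $w$ is the concatenation of $r/c$ copies of $w_0$ and $w'$ is the concatenation of $r'/c$ copies of $w_0$.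
   Context: Every element of the free product $P = H\ast G$ has a unique reduced word representation $s_1 s_2\cdots s_m$, i.e. one in which each $s_i \in (H\setminus\{e_H\}) \sqcup (G\setminus\{e_G\})$ and consecutive letters $s_i, s_{i+1}$ belong to different groups (the empty word represents the neutral element). A reduced word is of type 1 if it has the form $h_1 g_1 h_2 g_2 \cdots h_k g_k$ with $k \ge 1$, $h_i \in H\setminus\{e_H\}$ and $g_i\in G\setminus\{e_G\}$. *)

theory Defs
  imports "HOL-Algebra.Group"
begin

abbreviation fp_words :: "('a, 'm) monoid_scheme \<Rightarrow> ('b, 'n) monoid_scheme \<Rightarrow> ('a + 'b) list set"
  where "fp_words H G \<equiv> lists (carrier H <+> carrier G)"

text \<open>The congruence on words generated by deleting a neutral letter and by multiplying two
  neighbouring letters of the same group.\<close>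

inductive_set fp_rel ::
    "('a, 'm) monoid_scheme \<Rightarrow> ('b, 'n) monoid_scheme \<Rightarrow> (('a + 'b) list \<times> ('a + 'b) list) set"
  for H :: "('a, 'm) monoid_scheme" and G :: "('b, 'n) monoid_scheme"
  where
    fp_refl: "u \<in> fp_words H G \<Longrightarrow> (u, u) \<in> fp_rel H G"
  | fp_sym: "(u, v) \<in> fp_rel H G \<Longrightarrow> (v, u) \<in> fp_rel H G"
  | fp_trans: "(u, v) \<in> fp_rel H G \<Longrightarrow> (v, w) \<in> fp_rel H G \<Longrightarrow> (u, w) \<in> fp_rel H G"
  | fp_one_left: "u \<in> fp_words H G \<Longrightarrow> v \<in> fp_words H G
      \<Longrightarrow> (u @ [Inl \<one>\<^bsub>H\<^esub>] @ v, u @ v) \<in> fp_rel H G"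
  | fp_one_right: "u \<in> fp_words H G \<Longrightarrow> v \<in> fp_words H G
      \<Longrightarrow> (u @ [Inr \<one>\<^bsub>G\<^esub>] @ v, u @ v) \<in> fp_rel H G"
  | fp_mult_left: "u \<in> fp_words H G \<Longrightarrow> v \<in> fp_words H G \<Longrightarrow> a \<in> carrier H \<Longrightarrow> b \<in> carrier H
      \<Longrightarrow> (u @ [Inl a, Inl b] @ v, u @ [Inl (a \<otimes>\<^bsub>H\<^esub> b)] @ v) \<in> fp_rel H G"
  | fp_mult_right: "u \<in> fp_words H G \<Longrightarrow> v \<in> fp_words H G \<Longrightarrow> a \<in> carrier G \<Longrightarrow> b \<in> carrier G
      \<Longrightarrow> (u @ [Inr a, Inr b] @ v, u @ [Inr (a \<otimes>\<^bsub>G\<^esub> b)] @ v) \<in> fp_rel H G"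

text \<open>The element of the free product represented by a word.\<close>

definition fp_class ::
    "('a, 'm) monoid_scheme \<Rightarrow> ('b, 'n) monoid_scheme \<Rightarrow> ('a + 'b) list \<Rightarrow> ('a + 'b) list set"
  where "fp_class H G w = fp_rel H G `` {w}"

definition free_product ::
    "('a, 'm) monoid_scheme \<Rightarrow> ('b, 'n) monoid_scheme \<Rightarrow> ('a + 'b) list set monoid"
  where "free_product H G =
    \<lparr>carrier = fp_words H G // fp_rel H G,
     mult = (\<lambda>X Y. \<Union>u\<in>X. \<Union>v\<in>Y. fp_class H G (u @ v)),
     one = fp_class H G []\<rparr>"

definition reduced_word ::
    "('a, 'm) monoid_scheme \<Rightarrow> ('b, 'n) monoid_scheme \<Rightarrow> ('a + 'b) list \<Rightarrow> bool"
  where "reduced_word H G w \<longleftrightarrow>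
    w \<in> lists ((carrier H - {\<one>\<^bsub>H\<^esub>}) <+> (carrier G - {\<one>\<^bsub>G\<^esub>})) \<and>
    successively (\<lambda>s t. isl s \<noteq> isl t) w"

text \<open>Here \<open>k\<close> is the number of pairs \<open>h\<^sub>i g\<^sub>i\<close>, so the word has length \<open>2 * k\<close>; the index \<open>i\<close>
  runs from \<open>0\<close> to \<open>k - 1\<close>.\<close>

definition type1_word ::
    "('a, 'm) monoid_scheme \<Rightarrow> ('b, 'n) monoid_scheme \<Rightarrow> nat \<Rightarrow> ('a + 'b) list \<Rightarrow> bool"
  where "type1_word H G k w \<longleftrightarrow> k \<ge> 1 \<and> reduced_word H G w \<and>
    (\<exists>h g. (\<forall>i<k. h i \<in> carrier H - {\<one>\<^bsub>H\<^esub>} \<and> g i \<in> carrier G - {\<one>\<^bsub>G\<^esub>}) \<and>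
      w = concat (map (\<lambda>i. [Inl (h i), Inr (g i)]) [0..<k]))"


text \<open>The construction is a group, in which concatenation of words represents the product.\<close>

lemma fp_rel_words:
  assumes "group H" "group G" "(u, v) \<in> fp_rel H G"
  shows "u \<in> fp_words H G" "v \<in> fp_words H G"
proof -
  interpret H: group H by fact
  interpret G: group G by fact
  have "u \<in> fp_words H G \<and> v \<in> fp_words H G"
    using assms(3) by induction (simp_all add: InlI InrI)
  then show "u \<in> fp_words H G" "v \<in> fp_words H G" by blast+
qed

lemma equiv_fp_rel:
  assumes "group H" "group G"
  shows "equiv (fp_words H G) (fp_rel H G)"
proof (rule equivI)
  show "fp_rel H G \<subseteq> fp_words H G \<times> fp_words H G"
    by (rule subrelI) (intro SigmaI fp_rel_words[OF assms])
  show "refl_on (fp_words H G) (fp_rel H G)"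
    by (rule refl_onI) (rule fp_rel.fp_refl)
  show "sym (fp_rel H G)"
    by (rule symI) (rule fp_rel.fp_sym)
  show "trans (fp_rel H G)"
    by (rule transI) (rule fp_rel.fp_trans)
qed

lemma fp_rel_append_left:
  assumes "(u, v) \<in> fp_rel H G" "w \<in> fp_words H G"
  shows "(w @ u, w @ v) \<in> fp_rel H G"
  using assms(1)
proof induction
  case (fp_one_left u v)
  then show ?case using fp_rel.fp_one_left[of "w @ u" H G v] assms(2) by simp
next
  case (fp_one_right u v)
  then show ?case using fp_rel.fp_one_right[of "w @ u" H G v] assms(2) by simp
next
  case (fp_mult_left u v a b)
  then show ?case using fp_rel.fp_mult_left[of "w @ u" H G v a b] assms(2) by simp
next
  case (fp_mult_right u v a b)
  then show ?case using fp_rel.fp_mult_right[of "w @ u" H G v a b] assms(2) by simp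
next
  case (fp_trans u v w)
  then show ?case by (blast intro: fp_rel.fp_trans)
qed (use assms(2) in \<open>simp_all add: fp_rel.fp_refl fp_rel.fp_sym\<close>)

lemma fp_rel_append_right:
  assumes "(u, v) \<in> fp_rel H G" "w \<in> fp_words H G"
  shows "(u @ w, v @ w) \<in> fp_rel H G"
  using assms(1)
proof induction
  case (fp_one_left u v)
  then show ?case using fp_rel.fp_one_left[of u H G "v @ w"] assms(2) by simp
next
  case (fp_one_right u v)
  then show ?case using fp_rel.fp_one_right[of u H G "v @ w"] assms(2) by simp
next
  case (fp_mult_left u v a b)
  then show ?case using fp_rel.fp_mult_left[of u H G "v @ w" a b] assms(2) by simp
next
  case (fp_mult_right u v a b)
  then show ?case using fp_rel.fp_mult_right[of u H G "v @ w" a b] assms(2) by simp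
next
  case (fp_trans u v w)
  then show ?case by (blast intro: fp_rel.fp_trans)
qed (use assms(2) in \<open>simp_all add: fp_rel.fp_refl fp_rel.fp_sym\<close>)

lemma fp_class_mult:
  assumes "group H" "group G" "u \<in> fp_words H G" "v \<in> fp_words H G"
  shows "fp_class H G u \<otimes>\<^bsub>free_product H G\<^esub> fp_class H G v = fp_class H G (u @ v)"
proof -
  note E = equiv_fp_rel[OF assms(1,2)]
  have eq: "fp_class H G (u' @ v') = fp_class H G (u @ v)"
    if "u' \<in> fp_class H G u" "v' \<in> fp_class H G v" for u' v'
  proof -
    have r: "(u, u') \<in> fp_rel H G" "(v, v') \<in> fp_rel H G"
      using that by (auto simp: fp_class_def)
    have "v' \<in> fp_words H G" by (rule fp_rel_words(2)[OF assms(1,2) r(2)])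
    then have "(u @ v, u' @ v') \<in> fp_rel H G"
      by (rule fp_rel.fp_trans[OF fp_rel_append_left[OF r(2) assms(3)] fp_rel_append_right[OF r(1)]])
    then show ?thesis
      unfolding fp_class_def by (rule equiv_class_eq[OF E, symmetric])
  qed
  have "u \<in> fp_class H G u" "v \<in> fp_class H G v"
    unfolding fp_class_def using assms(3,4) by (simp_all only: Image_singleton_iff fp_rel.fp_refl)
  then have ne: "fp_class H G u \<noteq> {}" "fp_class H G v \<noteq> {}" by blast+
  have "fp_class H G u \<otimes>\<^bsub>free_product H G\<^esub> fp_class H G v =
      (\<Union>u'\<in>fp_class H G u. \<Union>v'\<in>fp_class H G v. fp_class H G (u' @ v'))"
    by (simp add: free_product_def)
  also have "\<dots> = (\<Union>u'\<in>fp_class H G u. \<Union>v'\<in>fp_class H G v. fp_class H G (u @ v))"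
    by (intro SUP_cong refl eq)
  also have "\<dots> = fp_class H G (u @ v)"
    using ne by simp
  finally show ?thesis .
qed

lemma group_free_product:
  assumes "group H" "group G"
  shows "group (free_product H G)"
proof -
  note M = fp_class_mult[OF assms]
  have CE: "\<exists>u. u \<in> fp_words H G \<and> X = fp_class H G u"
    if "X \<in> carrier (free_product H G)" for X
    using that unfolding free_product_def fp_class_def by (auto elim!: quotientE)
  have CI: "fp_class H G u \<in> carrier (free_product H G)" if "u \<in> fp_words H G" for u
    using that unfolding free_product_def fp_class_def by (simp add: quotientI)
  have O: "\<one>\<^bsub>free_product H G\<^esub> = fp_class H G []"
    by (simp add: free_product_def)
  have inv: "\<exists>v \<in> fp_words H G. (v @ u, []) \<in> fp_rel H G" if "u \<in> fp_words H G" for u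
    using that
  proof (induction u rule: list.induct)
    case Nil
    then show ?case by (auto intro: fp_rel.fp_refl)
  next
    case (Cons s u)
    have u: "u \<in> fp_words H G" and s: "s \<in> carrier H <+> carrier G" using Cons.prems by simp_all
    obtain v where v: "v \<in> fp_words H G" "(v @ u, []) \<in> fp_rel H G" using Cons.IH[OF u] by blast
    obtain t where t: "t \<in> carrier H <+> carrier G" "(v @ [t, s] @ u, v @ u) \<in> fp_rel H G"
    proof (cases s)
      case (Inl a)
      then have a: "a \<in> carrier H" using s by auto
      let ?b = "inv\<^bsub>H\<^esub> a"
      have b: "?b \<in> carrier H" "?b \<otimes>\<^bsub>H\<^esub> a = \<one>\<^bsub>H\<^esub>"
        using a assms(1) by (auto simp: group.l_inv)
      show ?thesis
        using that[of "Inl ?b"] b(1) Inl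
          fp_rel.fp_trans[OF fp_rel.fp_mult_left[OF v(1) u b(1) a, unfolded b(2)]
            fp_rel.fp_one_left[OF v(1) u]]
        by (simp add: InlI)
    next
      case (Inr a)
      then have a: "a \<in> carrier G" using s by auto
      let ?b = "inv\<^bsub>G\<^esub> a"
      have b: "?b \<in> carrier G" "?b \<otimes>\<^bsub>G\<^esub> a = \<one>\<^bsub>G\<^esub>"
        using a assms(2) by (auto simp: group.l_inv)
      show ?thesis
        using that[of "Inr ?b"] b(1) Inr
          fp_rel.fp_trans[OF fp_rel.fp_mult_right[OF v(1) u b(1) a, unfolded b(2)]
            fp_rel.fp_one_right[OF v(1) u]]
        by (simp add: InrI)
    qed
    have "((v @ [t]) @ s # u, []) \<in> fp_rel H G"
      using fp_rel.fp_trans[OF t(2) v(2)] by simp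
    then show ?case using v(1) t(1) by (intro bexI[of _ "v @ [t]"]) simp_all
  qed
  show ?thesis
  proof (rule groupI)
    fix X assume "X \<in> carrier (free_product H G)"
    then obtain u where u: "u \<in> fp_words H G" "X = fp_class H G u" using CE by blast
    obtain v where v: "v \<in> fp_words H G" "(v @ u, []) \<in> fp_rel H G" using inv[OF u(1)] by blast
    have "fp_class H G v \<otimes>\<^bsub>free_product H G\<^esub> X = \<one>\<^bsub>free_product H G\<^esub>"
      using M[OF v(1) u(1)] equiv_class_eq[OF equiv_fp_rel[OF assms] v(2)] u(2) O
      by (simp add: fp_class_def)
    then show "\<exists>Y \<in> carrier (free_product H G). Y \<otimes>\<^bsub>free_product H G\<^esub> X = \<one>\<^bsub>free_product H G\<^esub>"
      using CI[OF v(1)] by (rule bexI)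
  next
    fix X Y assume "X \<in> carrier (free_product H G)" "Y \<in> carrier (free_product H G)"
    then obtain u v where "u \<in> fp_words H G" "X = fp_class H G u"
      "v \<in> fp_words H G" "Y = fp_class H G v" using CE by meson
    then show "X \<otimes>\<^bsub>free_product H G\<^esub> Y \<in> carrier (free_product H G)"
      by (simp only: M CI append_in_lists_conv)
  next
    fix X Y Z
    assume "X \<in> carrier (free_product H G)" "Y \<in> carrier (free_product H G)"
      "Z \<in> carrier (free_product H G)"
    then obtain u v w where "u \<in> fp_words H G" "X = fp_class H G u"
      "v \<in> fp_words H G" "Y = fp_class H G v"
      "w \<in> fp_words H G" "Z = fp_class H G w" using CE by meson
    then show "X \<otimes>\<^bsub>free_product H G\<^esub> Y \<otimes>\<^bsub>free_product H G\<^esub> Z =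
        X \<otimes>\<^bsub>free_product H G\<^esub> (Y \<otimes>\<^bsub>free_product H G\<^esub> Z)"
      by (simp only: M append_in_lists_conv append_assoc)
  next
    fix X assume "X \<in> carrier (free_product H G)"
    then obtain u where u: "u \<in> fp_words H G" "X = fp_class H G u" using CE by blast
    then show "\<one>\<^bsub>free_product H G\<^esub> \<otimes>\<^bsub>free_product H G\<^esub> X = X"
      using M[OF lists.Nil u(1)] O by simp
  next
    show "\<one>\<^bsub>free_product H G\<^esub> \<in> carrier (free_product H G)"
      using CI[OF lists.Nil] O by simp
  qed
qed

end

theory Submission
  imports Defs
begin

text \<open>Let two elements with type 1 representatives \<open>w\<close> and \<open>w'\<close> commute. Both \<open>w @ w'\<close> and
  \<open>w' @ w\<close> are again reduced, since a type 1 word begins with a letter of \<open>H\<close> and ends with a letter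
  of \<open>G\<close>. They represent the same element, so they coincide as words by uniqueness of reduced
  representatives (\<open>reduced_word_unique\<close>). Two words that commute under concatenation are powers of
  a common word \<open>z\<close>. The length of \<open>z\<close> divides \<open>2 r\<close> and \<open>2 r'\<close>, hence also \<open>2 c\<close>, and so the
  power of \<open>z\<close> that has length \<open>2 c\<close> is the required \<open>w\<^sub>0\<close> (\<open>commuting_lists_common_root\<close>). It is of
  type 1 because it is a prefix of \<open>w\<close> of even length.

  Uniqueness of reduced representatives is proved with van der Waerden's method: the letters act on
  reduced words by left multiplication followed by reduction (\<open>fp_push\<close>). This action respects the
  products in \<open>H\<close> and \<open>G\<close>, so the result of applying a word to the empty word depends only on the
  class of the word; a reduced word applied to the empty word gives itself.\<close>


section \<open>Uniqueness of reduced representatives\<close>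

lemma reduced_word_Nil: "reduced_word H G []"
  by (simp add: reduced_word_def)

lemma reduced_word_Cons:
  "reduced_word H G (s # u) \<longleftrightarrow>
    s \<in> (carrier H - {\<one>\<^bsub>H\<^esub>}) <+> (carrier G - {\<one>\<^bsub>G\<^esub>}) \<and>
    (u \<noteq> [] \<longrightarrow> isl s \<noteq> isl (hd u)) \<and> reduced_word H G u"
  by (auto simp: reduced_word_def successively_Cons)

lemma reduced_word_append:
  "reduced_word H G (u @ v) \<longleftrightarrow>
    reduced_word H G u \<and> reduced_word H G v \<and>
    (u \<noteq> [] \<longrightarrow> v \<noteq> [] \<longrightarrow> isl (last u) \<noteq> isl (hd v))"
  by (auto simp: reduced_word_def successively_append_iff)

text \<open>The reduced word for the product of a letter and a reduced word. The neutral element needs no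
  separate treatment when both letters lie in the same group: then its product with the first letter
  of a reduced word is that letter, which is not neutral.\<close>

fun fp_push ::
    "('a, 'm) monoid_scheme \<Rightarrow> ('b, 'n) monoid_scheme \<Rightarrow> 'a + 'b \<Rightarrow> ('a + 'b) list \<Rightarrow> ('a + 'b) list"
  where
    "fp_push H G (Inl a) (Inl b # u) =
      (if a \<otimes>\<^bsub>H\<^esub> b = \<one>\<^bsub>H\<^esub> then u else Inl (a \<otimes>\<^bsub>H\<^esub> b) # u)"
  | "fp_push H G (Inr a) (Inr b # u) =
      (if a \<otimes>\<^bsub>G\<^esub> b = \<one>\<^bsub>G\<^esub> then u else Inr (a \<otimes>\<^bsub>G\<^esub> b) # u)"
  | "fp_push H G (Inl a) u = (if a = \<one>\<^bsub>H\<^esub> then u else Inl a # u)"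
  | "fp_push H G (Inr a) u = (if a = \<one>\<^bsub>G\<^esub> then u else Inr a # u)"

text \<open>The normal form of a word: the word acting on the empty word.\<close>

definition fp_reduce ::
    "('a, 'm) monoid_scheme \<Rightarrow> ('b, 'n) monoid_scheme \<Rightarrow> ('a + 'b) list \<Rightarrow> ('a + 'b) list"
  where "fp_reduce H G w = foldr (fp_push H G) w []"

lemma reduced_word_fp_push:
  assumes "group H" "group G" "s \<in> carrier H <+> carrier G" "reduced_word H G u"
  shows "reduced_word H G (fp_push H G s u)"
proof -
  interpret H: group H by fact
  interpret G: group G by fact
  show ?thesis
    using assms(3,4)
    by (cases "(H, G, s, u)" rule: fp_push.cases) (auto simp: reduced_word_Cons)
qed

lemma reduced_word_fp_reduce:
  assumes "group H" "group G" "w \<in> fp_words H G"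
  shows "reduced_word H G (fp_reduce H G w)"
  using assms(3)
  by (induction w)
    (auto simp: fp_reduce_def reduced_word_Nil intro!: reduced_word_fp_push[OF assms(1,2)])

lemma fp_push_one:
  assumes "group H" "group G" "reduced_word H G u"
  shows "fp_push H G (Inl \<one>\<^bsub>H\<^esub>) u = u" "fp_push H G (Inr \<one>\<^bsub>G\<^esub>) u = u"
proof -
  interpret H: group H by fact
  interpret G: group G by fact
  show "fp_push H G (Inl \<one>\<^bsub>H\<^esub>) u = u"
    using assms(3)
    by (cases "(H, G, Inl \<one>\<^bsub>H\<^esub> :: 'a + 'c, u)" rule: fp_push.cases) (auto simp: reduced_word_Cons)
  show "fp_push H G (Inr \<one>\<^bsub>G\<^esub>) u = u"
    using assms(3)
    by (cases "(H, G, Inr \<one>\<^bsub>G\<^esub> :: 'a + 'c, u)" rule: fp_push.cases) (auto simp: reduced_word_Cons)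
qed

lemma fp_push_Inl_mult:
  assumes "group H" "a \<in> carrier H" "b \<in> carrier H" "reduced_word H G u"
  shows "fp_push H G (Inl a) (fp_push H G (Inl b) u) = fp_push H G (Inl (a \<otimes>\<^bsub>H\<^esub> b)) u"
proof -
  interpret H: group H by fact
  consider c v where "u = Inl c # v" "c \<in> carrier H" "v = [] \<or> (\<exists>d t. v = Inr d # t)"
    | "u = [] \<or> (\<exists>d t. u = Inr d # t)"
  proof (cases u)
    case (Cons s v)
    with that assms(4) show ?thesis
      by (cases s; cases v; cases "hd v") (auto simp: reduced_word_Cons)
  qed (use that in simp)
  then show ?thesis
    using assms(2,3) by cases (auto simp: H.m_assoc)
qed

lemma fp_push_Inr_mult:
  assumes "group G" "a \<in> carrier G" "b \<in> carrier G" "reduced_word H G u"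
  shows "fp_push H G (Inr a) (fp_push H G (Inr b) u) = fp_push H G (Inr (a \<otimes>\<^bsub>G\<^esub> b)) u"
proof -
  interpret G: group G by fact
  consider c v where "u = Inr c # v" "c \<in> carrier G" "v = [] \<or> (\<exists>d t. v = Inl d # t)"
    | "u = [] \<or> (\<exists>d t. u = Inl d # t)"
  proof (cases u)
    case (Cons s v)
    with that assms(4) show ?thesis
      by (cases s; cases v; cases "hd v") (auto simp: reduced_word_Cons)
  qed (use that in simp)
  then show ?thesis
    using assms(2,3) by cases (auto simp: G.m_assoc)
qed

lemma fp_reduce_eq_if_fp_rel:
  assumes "group H" "group G" "(u, v) \<in> fp_rel H G"
  shows "fp_reduce H G u = fp_reduce H G v"
  using assms(3)
proof induction
  case (fp_one_left u v)
  then show ?case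
    using fp_push_one(1)[OF assms(1,2) reduced_word_fp_reduce[OF assms(1,2)]]
    by (simp add: fp_reduce_def)
next
  case (fp_one_right u v)
  then show ?case
    using fp_push_one(2)[OF assms(1,2) reduced_word_fp_reduce[OF assms(1,2)]]
    by (simp add: fp_reduce_def)
next
  case (fp_mult_left u v a b)
  then show ?case
    using fp_push_Inl_mult[OF assms(1) _ _ reduced_word_fp_reduce[OF assms(1,2)]]
    by (simp add: fp_reduce_def)
next
  case (fp_mult_right u v a b)
  then show ?case
    using fp_push_Inr_mult[OF assms(2) _ _ reduced_word_fp_reduce[OF assms(1,2)]]
    by (simp add: fp_reduce_def)
qed simp_all

lemma fp_reduce_reduced_word: "reduced_word H G w \<Longrightarrow> fp_reduce H G w = w"
proof (induction w)
  case (Cons s u)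
  then have "fp_reduce H G (s # u) = fp_push H G s u"
    by (simp add: fp_reduce_def reduced_word_Cons)
  also have "\<dots> = s # u"
    using Cons.prems by (cases "(H, G, s, u)" rule: fp_push.cases) (auto simp: reduced_word_Cons)
  finally show ?case .
qed (simp add: fp_reduce_def)

lemma reduced_word_in_fp_words: "reduced_word H G w \<Longrightarrow> w \<in> fp_words H G"
  by (auto simp: reduced_word_def)

lemma reduced_word_unique:
  assumes "group H" "group G" "reduced_word H G u" "reduced_word H G v"
    and "fp_class H G u = fp_class H G v"
  shows "u = v"
proof -
  have "(u, v) \<in> fp_rel H G"
    using eq_equiv_class[OF assms(5)[unfolded fp_class_def] equiv_fp_rel[OF assms(1,2)]]
      reduced_word_in_fp_words[OF assms(4)] by blast
  then show ?thesis
    using fp_reduce_eq_if_fp_rel[OF assms(1,2)] fp_reduce_reduced_word assms(3,4) by metis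
qed


section \<open>Commuting words\<close>

lemma concat_replicate_mult:
  "concat (replicate (m * n) xs) = concat (replicate m (concat (replicate n xs)))"
  by (induction m) (simp_all add: replicate_add)

lemma length_concat_replicate: "length (concat (replicate n xs)) = n * length xs"
  by (induction n) simp_all

text \<open>If \<open>xs\<close> and \<open>ys\<close> are the \<open>m\<close>-th and \<open>n\<close>-th powers of one list, they are also powers of the
  \<open>gcd m n\<close>-th power of that list, whose length is the greatest common divisor of their lengths.\<close>

lemma commuting_lists_common_root:
  assumes "xs @ ys = ys @ xs"
  defines "d \<equiv> gcd (length xs) (length ys)"
  shows "\<exists>zs. length zs = d \<and> xs = concat (replicate (length xs div d) zs) \<and>
    ys = concat (replicate (length ys div d) zs)"
proof (cases "d = 0")
  case True
  then show ?thesis by (simp add: d_def)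
next
  case False
  obtain m n zs where xs: "xs = concat (replicate m zs)" and ys: "ys = concat (replicate n zs)"
    using comm_append_are_replicate[OF assms(1)] by metis
  have lx: "length xs = m * length zs" and ly: "length ys = n * length zs"
    using xs ys length_concat_replicate by blast+
  then have dg: "d = gcd m n * length zs"
    by (simp add: d_def gcd_mult_distrib_nat mult.commute)
  with False have pos: "length zs > 0" by auto
  let ?z = "concat (replicate (gcd m n) zs)"
  have "length xs div d * gcd m n = m" "length ys div d * gcd m n = n"
    using pos unfolding lx ly dg by simp_all
  then have "xs = concat (replicate (length xs div d) ?z)"
    "ys = concat (replicate (length ys div d) ?z)"
    using xs ys concat_replicate_mult by metis+
  then show ?thesis
    using dg length_concat_replicate by metis
qed


section \<open>Words of type 1\<close>

lemma length_concat_map_pairs: "length (concat (map (\<lambda>i. [f i, g i]) ns)) = 2 * length ns"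
  by (induction ns) simp_all

lemma length_type1_word: "type1_word H G k w \<Longrightarrow> length w = 2 * k"
  by (auto simp: type1_word_def length_concat_map_pairs)

lemma reduced_word_append_type1:
  assumes "type1_word H G k w" "type1_word H G l v"
  shows "reduced_word H G (w @ v)"
proof -
  obtain h g where k: "k \<ge> 1" and w: "w = concat (map (\<lambda>i. [Inl (h i), Inr (g i)]) [0..<k])"
    using assms(1) by (auto simp: type1_word_def)
  obtain h' g' where l: "l \<ge> 1" and v: "v = concat (map (\<lambda>i. [Inl (h' i), Inr (g' i)]) [0..<l])"
    using assms(2) by (auto simp: type1_word_def)
  have "\<not> isl (last w)"
    using k unfolding w by (cases k) simp_all
  moreover have "isl (hd v)"
    using l unfolding v by (simp add: upt_conv_Cons)
  ultimately show ?thesis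
    using assms by (simp add: reduced_word_append type1_word_def)
qed

lemma type1_word_take:
  assumes "type1_word H G k w" "1 \<le> l" "l \<le> k"
  shows "type1_word H G l (take (2 * l) w)"
proof -
  obtain h g
    where hg: "\<forall>i<k. h i \<in> carrier H - {\<one>\<^bsub>H\<^esub>} \<and> g i \<in> carrier G - {\<one>\<^bsub>G\<^esub>}"
      and w: "w = concat (map (\<lambda>i. [Inl (h i), Inr (g i)]) [0..<k])"
    using assms(1) by (auto simp: type1_word_def)
  let ?p = "\<lambda>ns. concat (map (\<lambda>i. [Inl (h i), Inr (g i)]) ns)"
  have "w = ?p [0..<l] @ ?p [l..<k]"
    using upt_add_eq_append[of 0 l "k - l"] assms(3) by (simp add: w)
  moreover have "length (?p [0..<l]) = 2 * l"
    by (simp only: length_concat_map_pairs length_upt diff_zero)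
  ultimately have take: "take (2 * l) w = ?p [0..<l]"
    by (simp only: take_append take_all order_refl diff_self_eq_0 take_0 append_Nil2)
  have "reduced_word H G (take (2 * l) w)"
    using assms(1) reduced_word_append[of H G "take (2 * l) w" "drop (2 * l) w"]
    by (simp add: type1_word_def)
  moreover have "\<forall>i<l. h i \<in> carrier H - {\<one>\<^bsub>H\<^esub>} \<and> g i \<in> carrier G - {\<one>\<^bsub>G\<^esub>}"
    using hg assms(3) by simp
  ultimately show ?thesis
    using assms(2) take unfolding type1_word_def by blast
qed


section \<open>Commuting elements of the free product\<close>

theorem proposition1p1:
  fixes H :: "('a, 'm) monoid_scheme" and G :: "('b, 'n) monoid_scheme"
    and P :: "('a + 'b) list set monoid"
    and r r' c :: nat and w w' :: "('a + 'b) list" and x x' :: "('a + 'b) list set"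
  assumes "group H" and "group G"
    and "P = free_product H G"
    and "r \<ge> 1" and "r' \<ge> 1"
    and "type1_word H G r w" and "type1_word H G r' w'"
    and "x = fp_class H G w" and "x' = fp_class H G w'"
    and "x \<otimes>\<^bsub>P\<^esub> x' = x' \<otimes>\<^bsub>P\<^esub> x"
    and "c = gcd r r'"
  shows "\<exists>w0. type1_word H G c w0 \<and>
    w = concat (replicate (r div c) w0) \<and> w' = concat (replicate (r' div c) w0)"
proof -
  have red: "reduced_word H G w" "reduced_word H G w'"
    using assms(6,7) by (simp_all add: type1_word_def)
  have "fp_class H G (w @ w') = fp_class H G (w' @ w)"
    using assms(10) red[THEN reduced_word_in_fp_words]
    by (simp add: assms(3,8,9) fp_class_mult[OF assms(1,2)])
  then have comm: "w @ w' = w' @ w"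
    by (rule reduced_word_unique[OF assms(1,2) reduced_word_append_type1[OF assms(6,7)]
      reduced_word_append_type1[OF assms(7,6)]])
  have len: "length w = 2 * r" "length w' = 2 * r'"
    using assms(6,7) by (simp_all add: length_type1_word)
  then have "gcd (length w) (length w') = 2 * c"
    by (simp add: assms(11) gcd_mult_distrib_nat)
  then obtain w0 where w0: "length w0 = 2 * c"
    "w = concat (replicate (r div c) w0)" "w' = concat (replicate (r' div c) w0)"
    using commuting_lists_common_root[OF comm] len by auto
  have c: "1 \<le> c" "c \<le> r"
    using assms(4) by (auto simp: assms(11) Suc_le_eq intro: gcd_le1_nat)
  then have "r div c \<noteq> 0"
    by (simp add: div_eq_0_iff)
  then have "take (2 * c) w = w0"
    using w0(1,2) by (cases "r div c") simp_all
  then show ?thesis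
    using type1_word_take[OF assms(6) c] w0(2,3) by auto
qed

end
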